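(* Let $r,d\in\mathbb{N}$ and let $D_d\subset\mathbb{R}^d$ be an open set of $d$-dimensional volume $1$. For any $\delta\in(0,1)$ and $\varepsilon\in(0,\delta]$ we have $$ n(\varepsilon,D_d,r)\;\ge\;(1-\delta)\,c_r^d\left(\frac{\delta\,d}{\varepsilon}\right)^{d/r}\qquad\text{with}\qquad c_r=\frac{1}{6\,e\,r^{1-1/r}}. $$ Taking $\delta=d/(d+r)$, which maximizes the right-hand side as a function of $\delta\in(0,1)$, one obtains, for all $\varepsilon\in(0,d/(d+r)]$, $$ n(\varepsilon,D_d,r)\;\ge\;\frac{r}{r+d}\left(\frac{d}{d+r}\;\frac{1}{6^r e^r r^{r-1}}\;\frac{d}{\varepsilon}\right)^{d/r}. $$ Here $e$ denotes Euler's number.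
   Context: Here $\mathbb{N}=\{1,2,\dots\}$, $\mathbb{N}_0=\{0,1,2,\dots\}$, and $|\beta|_1=\beta_1+\dots+\beta_d$ for $\beta\in\mathbb{N}_0^d$; $D^\beta$ is the partial derivative of order $\beta$. Let $\mathcal{C}^r(D_d)$ be the class of all $r$-times continuously differentiable functions $f:D_d\to\mathbb{R}$ with $\sup_{x\in D_d}|(D^\beta f)(x)|\le 1$ for all $\beta\in\mathbb{N}_0^d$ with $|\beta|_1\le r$. The problem is to approximate $S(f)=\int_{D_d} f(x)\,dx$ for $f\in\mathcal{C}^r(D_d)$. An algorithm using $n$ function values is a map $A_n:\mathcal{C}^r(D_d)\to\mathbb{R}$ of the form $A_n(f)=\phi_n(f(x_1),\dots,f(x_n))$, where $\phi_n:\mathbb{R}^n\to\mathbb{R}$ is an arbitrary (possibly nonlinear) map and the sample points $x_i\in D_d$ may be chosen adaptively, i.e., $x_i$ may depend on the already computed values $f(x_1),\dots,f(x_{i-1})$ (for $n=0$, $A_0$ is a constant). Its worst case error is $e(A_n)=\sup_{f\in\mathcal{C}^r(D_d)}|S(f)-A_n(f)|$, and the $n$th minimal error is $e_n(\mathcal{C}^r(D_d))=\inf_{A_n}e(A_n)$, the infimum being over all such algorithms. Define $$n(\varepsilon,D_d,r)=\min\{n\in\mathbb{N}_0:\ e_n(\mathcal{C}^r(D_d))\le\varepsilon\}.$$ *)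

theory Defs
  imports "HOL-Analysis.Analysis"
begin

text \<open>
  Functions on an open set \<open>D\<close> are total functions of which only the values on \<open>D\<close> matter; since
  \<open>D\<close> is open, partial derivatives at points of \<open>D\<close> do not depend on values outside \<open>D\<close>.
\<close>

definition partial_deriv :: "'d \<Rightarrow> (real ^ 'd \<Rightarrow> real) \<Rightarrow> real ^ 'd::finite \<Rightarrow> real" where
  "partial_deriv i f x = deriv (\<lambda>t. f (x + t *\<^sub>R axis i 1)) 0"

definition has_partial :: "'d \<Rightarrow> (real ^ 'd \<Rightarrow> real) \<Rightarrow> real ^ 'd::finite \<Rightarrow> bool" where
  "has_partial i f x \<longleftrightarrow> (\<lambda>t. f (x + t *\<^sub>R axis i 1)) field_differentiable at 0"

text \<open>All iterated partial derivatives of order at most \<open>r\<close>, taken in any order of the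
  coordinates, exist and are continuous on \<open>D\<close>.\<close>

primrec cont_diff_on :: "nat \<Rightarrow> (real ^ 'd::finite) set \<Rightarrow> (real ^ 'd \<Rightarrow> real) \<Rightarrow> bool" where
  "cont_diff_on 0 D f \<longleftrightarrow> continuous_on D f"
| "cont_diff_on (Suc r) D f \<longleftrightarrow> continuous_on D f \<and>
     (\<forall>i. (\<forall>x\<in>D. has_partial i f x) \<and> cont_diff_on r D (partial_deriv i f))"

text \<open>The index type carries no order, so an enumeration of the coordinates is chosen. On open
  sets the choice is irrelevant for \<open>r\<close> times continuously differentiable functions and
  derivatives of order at most \<open>r\<close>, by symmetry of partial derivatives.\<close>

definition coords :: "'d::finite list" where
  "coords = (SOME is. distinct is \<and> set is = UNIV)"

lemma coords: "distinct (coords :: 'd::finite list)" "set (coords :: 'd list) = UNIV"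
proof -
  have "\<exists>is :: 'd list. distinct is \<and> set is = UNIV"
    using finite_distinct_list[of "UNIV :: 'd set"] by auto
  from someI_ex[OF this] show "distinct (coords :: 'd list)" "set (coords :: 'd list) = UNIV"
    unfolding coords_def by auto
qed

definition multi_deriv ::
    "('d \<Rightarrow> nat) \<Rightarrow> (real ^ 'd::finite \<Rightarrow> real) \<Rightarrow> real ^ 'd \<Rightarrow> real" where
  "multi_deriv \<beta> f = foldr (\<lambda>i. partial_deriv i ^^ \<beta> i) coords f"

definition C_class :: "nat \<Rightarrow> (real ^ 'd::finite) set \<Rightarrow> (real ^ 'd \<Rightarrow> real) set" where
  "C_class r D = {f. cont_diff_on r D f \<and>
     (\<forall>\<beta>. (\<Sum>i\<in>UNIV. \<beta> i) \<le> r \<longrightarrow> (\<forall>x\<in>D. \<bar>multi_deriv \<beta> f x\<bar> \<le> 1))}"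

definition integral_on :: "(real ^ 'd::finite) set \<Rightarrow> (real ^ 'd \<Rightarrow> real) \<Rightarrow> real" where
  "integral_on D f = (LINT x:D|lborel. f x)"

text \<open>The next sample point is \<open>\<psi>\<close> applied to the list of the values computed so far; in
  particular the first one, \<open>\<psi> []\<close>, does not depend on \<open>f\<close>.\<close>

primrec info :: "(real list \<Rightarrow> real ^ 'd::finite) \<Rightarrow> (real ^ 'd \<Rightarrow> real) \<Rightarrow> nat \<Rightarrow> real list" where
  "info \<psi> f 0 = []"
| "info \<psi> f (Suc k) = info \<psi> f k @ [f (\<psi> (info \<psi> f k))]"

definition algorithms ::
    "nat \<Rightarrow> (real ^ 'd::finite) set \<Rightarrow> ((real ^ 'd \<Rightarrow> real) \<Rightarrow> real) set" where
  "algorithms n D = {\<lambda>f. \<phi> (info \<psi> f n) | (\<phi> :: real list \<Rightarrow> real) \<psi>. \<forall>ys. \<psi> ys \<in> D}"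

definition worst_case_error ::
    "nat \<Rightarrow> (real ^ 'd::finite) set \<Rightarrow> ((real ^ 'd \<Rightarrow> real) \<Rightarrow> real) \<Rightarrow> ereal" where
  "worst_case_error r D A = (SUP f\<in>C_class r D. ereal \<bar>integral_on D f - A f\<bar>)"

definition minimal_error :: "nat \<Rightarrow> (real ^ 'd::finite) set \<Rightarrow> nat \<Rightarrow> ereal" where
  "minimal_error r D n = (INF A\<in>algorithms n D. worst_case_error r D A)"

text \<open>The infimum of a nonempty set of extended naturals is its minimum; that of the empty set
  is \<open>\<infinity>\<close>.\<close>

definition info_complexity :: "real \<Rightarrow> (real ^ 'd::finite) set \<Rightarrow> nat \<Rightarrow> enat" where
  "info_complexity \<epsilon> D r = (INF n\<in>{n. minimal_error r D n \<le> ereal \<epsilon>}. enat n)"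

definition c_const :: "nat \<Rightarrow> real" where
  "c_const r = 1 / (6 * exp 1 * real r powr (1 - 1 / real r))"

definition lower_bound :: "nat \<Rightarrow> nat \<Rightarrow> real \<Rightarrow> real \<Rightarrow> real" where
  "lower_bound r d \<epsilon> \<delta> =
     (1 - \<delta>) * c_const r ^ d * (\<delta> * real d / \<epsilon>) powr (real d / real r)"

end

theory Submission
  imports Defs
begin

text \<open>
  The lower bound is proved with fooling functions. An algorithm that sees only zeros samples at
  \<open>n\<close> fixed points, even if it is adaptive. If some \<open>F\<close> in the class vanishes at these points,
  then the algorithm returns the same number for \<open>F\<close> and \<open>- F\<close>, so its error is at least \<open>S(F)\<close>.
  It remains to construct such an \<open>F \<ge> 0\<close> with a large integral: with \<open>h = \<epsilon> / \<delta>\<close>, the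
  function \<open>F\<close> equals \<open>h\<close> off the balls of some radius \<open>\<rho>\<close> around the sample points. If each
  ball has volume at most \<open>V\<close>, then \<open>S(F) \<ge> h (1 - n V)\<close>, and this exceeds \<open>\<epsilon>\<close> as soon as
  \<open>n V < 1 - \<delta>\<close>. Hence \<open>n \<ge> (1 - \<delta>) / V\<close> (\<open>info_complexity_lower_bound\<close>).

  The balls are taken in the norm \<open>\<Sum>i. \<bar>x $ i\<bar>\<close>, because a function that is \<open>L\<close>-Lipschitz
  for it is exactly one whose change along each coordinate direction has rate at most \<open>L\<close>, and
  because its balls are very small in high dimension: a Chernoff-type estimate gives the volume
  bound \<open>(2 e \<rho> / d)\<^sup>d\<close> (\<open>emeasure_l1_ball_le\<close>).

  To obtain \<open>F\<close> (\<open>exists_fooling_function\<close>), let \<open>0 < t \<le> 1\<close> satisfy \<open>h = d r t\<^sup>r\<close>. Start with a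
  function \<open>f\<close> that is \<open>0\<close> up to distance \<open>R = d r t\<close> from the points, then climbs with slope
  \<open>t\<^bsup>r-1\<^esup>\<close> and reaches \<open>h\<close> after the further distance \<open>h / t\<^bsup>r-1\<^esup> = R\<close>. Average \<open>f\<close> over cubes
  of side \<open>2 t\<close>, and do so \<open>r\<close> times. An average over a cube is a composition of averages over
  segments, one for each coordinate. The derivative of a segment average is a central difference
  quotient. Its Lipschitz constant is that of the function divided by \<open>t\<close>, but its values are
  bounded by the Lipschitz constant of the function itself. Thus a derivative of \<open>F\<close> of order
  \<open>k\<close> with \<open>1 \<le> k \<le> r\<close> is at most \<open>t\<^bsup>r-1\<^esup> / t\<^bsup>k-1\<^esup> \<le> 1\<close>
  (\<open>smoothed_bound\<close>, \<open>C_class_of_smoothed\<close>). Averaging uses values of \<open>f\<close> up to distance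
  \<open>d r t = R\<close> only (\<open>smoothed_range\<close>); so \<open>F\<close> still vanishes at the points and equals \<open>h\<close> beyond
  \<open>\<rho> = 3 R\<close>. This makes \<open>V = (6 e r t)\<^sup>d\<close>, and \<open>1 / V\<close> is \<open>c_r\<^sup>d (\<delta> d / \<epsilon>)\<^bsup>d/r\<^esup>\<close>.

  The best \<open>\<delta>\<close> maximizes \<open>(1 - \<delta>) \<delta>\<^bsup>d/r\<^esup>\<close>, a weighted inequality of arithmetic and geometric
  means (\<open>one_minus_times_powr_le\<close>).
\<close>

section \<open>Lipschitz functions for the sum norm\<close>

definition l1_norm :: "real ^ 'd::finite \<Rightarrow> real" where
  "l1_norm x = (\<Sum>i\<in>UNIV. \<bar>x $ i\<bar>)"

definition l1_lipschitz :: "real \<Rightarrow> (real ^ 'd::finite \<Rightarrow> real) \<Rightarrow> bool" where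
  "l1_lipschitz L g \<longleftrightarrow> (\<forall>x y. \<bar>g x - g y\<bar> \<le> L * l1_norm (x - y))"

lemma l1_lipschitzD: "l1_lipschitz L g \<Longrightarrow> \<bar>g x - g y\<bar> \<le> L * l1_norm (x - y)"
  by (simp add: l1_lipschitz_def)

lemma l1_norm_nonneg: "0 \<le> l1_norm x"
  by (simp add: l1_norm_def sum_nonneg)

lemma l1_norm_minus: "l1_norm (- x) = l1_norm x"
  by (simp add: l1_norm_def)

lemma l1_norm_triangle: "l1_norm (x + y) \<le> l1_norm x + l1_norm y"
  by (simp add: l1_norm_def sum.distrib [symmetric] sum_mono)

lemma l1_norm_axis: "l1_norm (c *\<^sub>R axis i 1) = \<bar>c\<bar>"
proof -
  have "(\<Sum>j\<in>UNIV. \<bar>(c *\<^sub>R axis i (1::real)) $ j\<bar>) = (\<Sum>j\<in>UNIV. if j = i then \<bar>c\<bar> else 0)"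
    by (intro sum.cong) (auto simp: axis_def)
  then show ?thesis
    by (simp add: l1_norm_def)
qed

lemma continuous_on_l1_norm [continuous_intros]:
  "continuous_on S f \<Longrightarrow> continuous_on S (\<lambda>x. l1_norm (f x))"
  unfolding l1_norm_def by (intro continuous_intros)

lemma l1_lipschitz_continuous:
  assumes "l1_lipschitz L g"
  shows "continuous_on UNIV g"
proof -
  have "isCont g x" for x
  proof -
    have "continuous_on UNIV (\<lambda>y. L * l1_norm (y - x))"
      by (intro continuous_intros)
    then have "isCont (\<lambda>y. L * l1_norm (y - x)) x"
      by (simp add: continuous_on_eq_continuous_at)
    then have "((\<lambda>y. L * l1_norm (y - x)) \<longlongrightarrow> 0) (at x)"
      by (simp add: isCont_def l1_norm_def)
    then have "((\<lambda>y. g y - g x) \<longlongrightarrow> 0) (at x)"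
      by (rule Lim_null_comparison [rotated]) (use assms in \<open>auto simp: l1_lipschitz_def\<close>)
    then show ?thesis
      by (simp add: isCont_def LIM_zero_iff)
  qed
  then show ?thesis
    by (simp add: continuous_at_imp_continuous_on)
qed

lemma l1_lipschitz_uminus: "l1_lipschitz L g \<Longrightarrow> l1_lipschitz L (\<lambda>x. - g x)"
  by (simp add: l1_lipschitz_def abs_minus_commute)

section \<open>Partial derivatives along lines\<close>

lemma continuous_along_axis:
  fixes g :: "real ^ 'd::finite \<Rightarrow> real"
  assumes "continuous_on UNIV g"
  shows "continuous_on S (\<lambda>u. g (x + u *\<^sub>R axis i 1))"
  by (rule continuous_on_compose2 [OF assms]) (auto intro!: continuous_intros)

lemma integrable_along_axis:
  fixes g :: "real ^ 'd::finite \<Rightarrow> real"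
  assumes "continuous_on UNIV g"
  shows "(\<lambda>u. g (x + u *\<^sub>R axis i 1)) integrable_on {a..b}"
  by (intro integrable_continuous_interval continuous_along_axis assms)

lemma has_partialI:
  assumes "((\<lambda>\<tau>. f (x + \<tau> *\<^sub>R axis i 1)) has_field_derivative D) (at 0)"
  shows "has_partial i f x" and "partial_deriv i f x = D"
  using assms DERIV_imp_deriv [OF assms]
  by (auto simp: has_partial_def partial_deriv_def field_differentiable_def)

text \<open>Differentiation under the integral sign needs the derivative along a coordinate line at every
  parameter, whereas \<open>has_partial\<close> only speaks of the parameter \<open>0\<close>.\<close>

lemma has_partialD:
  assumes "has_partial i f (x + \<tau>0 *\<^sub>R axis i 1)"
  shows "((\<lambda>\<tau>. f (x + \<tau> *\<^sub>R axis i 1)) has_field_derivative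
           partial_deriv i f (x + \<tau>0 *\<^sub>R axis i 1)) (at \<tau>0)"
proof -
  have "((\<lambda>\<tau>. f (x + \<tau>0 *\<^sub>R axis i 1 + \<tau> *\<^sub>R axis i 1)) has_field_derivative
          partial_deriv i f (x + \<tau>0 *\<^sub>R axis i 1)) (at 0)"
    using assms unfolding has_partial_def partial_deriv_def
    by (simp add: field_differentiable_derivI)
  then show ?thesis
    using DERIV_shift [of "\<lambda>\<tau>. f (x + \<tau> *\<^sub>R axis i 1)" "partial_deriv i f (x + \<tau>0 *\<^sub>R axis i 1)" 0 \<tau>0]
    by (simp add: algebra_simps)
qed

section \<open>Averaging over segments\<close>

definition axis_avg :: "real \<Rightarrow> 'd \<Rightarrow> (real ^ 'd::finite \<Rightarrow> real) \<Rightarrow> real ^ 'd \<Rightarrow> real" where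
  "axis_avg t i g x = integral {-t..t} (\<lambda>u. g (x + u *\<^sub>R axis i 1)) / (2 * t)"

definition axis_diff :: "real \<Rightarrow> 'd \<Rightarrow> (real ^ 'd::finite \<Rightarrow> real) \<Rightarrow> real ^ 'd \<Rightarrow> real" where
  "axis_diff t i g x = (g (x + t *\<^sub>R axis i 1) - g (x - t *\<^sub>R axis i 1)) / (2 * t)"

lemma axis_avg_bounds:
  assumes "t > 0" and g: "continuous_on UNIV g"
    and "\<And>u. \<bar>u\<bar> \<le> t \<Longrightarrow> A \<le> g (x + u *\<^sub>R axis i 1) \<and> g (x + u *\<^sub>R axis i 1) \<le> B"
  shows "A \<le> axis_avg t i g x \<and> axis_avg t i g x \<le> B"
proof (intro conjI)
  have *: "u \<in> {-t..t} \<Longrightarrow> A \<le> g (x + u *\<^sub>R axis i 1) \<and> g (x + u *\<^sub>R axis i 1) \<le> B" for u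
    using assms(3) [of u] by auto
  have "integral {-t..t} (\<lambda>u. A) \<le> integral {-t..t} (\<lambda>u. g (x + u *\<^sub>R axis i 1))"
    using * by (intro integral_le integrable_along_axis g) auto
  then show "A \<le> axis_avg t i g x"
    using \<open>t > 0\<close> by (simp add: axis_avg_def field_simps)
  have "integral {-t..t} (\<lambda>u. g (x + u *\<^sub>R axis i 1)) \<le> integral {-t..t} (\<lambda>u. B)"
    using * by (intro integral_le integrable_along_axis g) auto
  then show "axis_avg t i g x \<le> B"
    using \<open>t > 0\<close> by (simp add: axis_avg_def field_simps)
qed

lemma axis_avg_lipschitz:
  fixes g :: "real ^ 'd::finite \<Rightarrow> real"
  assumes "t > 0" and "l1_lipschitz L g"
  shows "l1_lipschitz L (axis_avg t i g)"
  unfolding l1_lipschitz_def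
proof (intro allI)
  fix x y :: "real ^ 'd"
  note g = l1_lipschitz_continuous [OF assms(2)]
  \<comment> \<open>Averaging commutes with translations, so the difference of two averages is the average of \<open>k\<close>.\<close>
  define k where "k z = g z - g (z + (y - x))" for z
  have k: "continuous_on UNIV k"
    unfolding k_def
    by (intro continuous_on_diff g continuous_on_compose2 [OF g]) (auto intro!: continuous_intros)
  have eq: "axis_avg t i g x - axis_avg t i g y = axis_avg t i k x"
    unfolding axis_avg_def k_def diff_divide_distrib [symmetric]
    by (subst integral_diff [symmetric]) (auto simp: g integrable_along_axis algebra_simps)
  have kb: "\<bar>k z\<bar> \<le> L * l1_norm (x - y)" for z
  proof -
    have "z - (z + (y - x)) = x - y"
      by (simp add: algebra_simps)
    then show ?thesis
      using l1_lipschitzD [OF assms(2), of z "z + (y - x)"] by (simp add: k_def)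
  qed
  have "- (L * l1_norm (x - y)) \<le> k z \<and> k z \<le> L * l1_norm (x - y)" for z
    using kb [of z] by (simp add: abs_le_iff)
  then have "- (L * l1_norm (x - y)) \<le> axis_avg t i k x \<and> axis_avg t i k x \<le> L * l1_norm (x - y)"
    by (intro axis_avg_bounds [OF \<open>t > 0\<close> k])
  then show "\<bar>axis_avg t i g x - axis_avg t i g y\<bar> \<le> L * l1_norm (x - y)"
    by (simp add: eq abs_le_iff)
qed

lemma axis_diff_lipschitz:
  fixes g :: "real ^ 'd::finite \<Rightarrow> real"
  assumes "t > 0" and "l1_lipschitz L g"
  shows "l1_lipschitz (L / t) (axis_diff t i g)"
  unfolding l1_lipschitz_def
proof (intro allI)
  fix x y :: "real ^ 'd"
  let ?e = "t *\<^sub>R axis i (1::real) :: real ^ 'd"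
  have "(x + ?e) - (y + ?e) = x - y" "(x - ?e) - (y - ?e) = x - y"
    by simp_all
  then have "\<bar>g (x + ?e) - g (y + ?e)\<bar> \<le> L * l1_norm (x - y)"
    "\<bar>g (x - ?e) - g (y - ?e)\<bar> \<le> L * l1_norm (x - y)"
    using l1_lipschitzD [OF assms(2), of "x + ?e" "y + ?e"]
      l1_lipschitzD [OF assms(2), of "x - ?e" "y - ?e"] by metis+
  then have "\<bar>(g (x + ?e) - g (x - ?e)) - (g (y + ?e) - g (y - ?e))\<bar> \<le> 2 * (L * l1_norm (x - y))"
    by linarith
  then show "\<bar>axis_diff t i g x - axis_diff t i g y\<bar> \<le> L / t * l1_norm (x - y)"
    using \<open>t > 0\<close>
    by (simp add: axis_diff_def diff_divide_distrib [symmetric] abs_divide field_simps)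
qed

text \<open>The step that spends the Lipschitz constant: the two points are \<open>2 t\<close> apart, so no factor
  \<open>1 / t\<close> appears.\<close>

lemma axis_diff_bound:
  assumes "t > 0" and "l1_lipschitz L g"
  shows "\<bar>axis_diff t i g x\<bar> \<le> L"
proof -
  have eq: "(x + t *\<^sub>R axis i 1) - (x - t *\<^sub>R axis i 1) = (2 * t) *\<^sub>R axis i (1::real)"
    by (simp add: scaleR_2 flip: scaleR_scaleR)
  have "\<bar>g (x + t *\<^sub>R axis i 1) - g (x - t *\<^sub>R axis i 1)\<bar> \<le> L * (2 * t)"
    using l1_lipschitzD [OF assms(2), of "x + t *\<^sub>R axis i 1" "x - t *\<^sub>R axis i 1"] \<open>t > 0\<close>
    unfolding eq l1_norm_axis by simp
  then show ?thesis
    using \<open>t > 0\<close> by (simp add: axis_diff_def abs_divide field_simps)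
qed

text \<open>Moving \<open>x\<close> along the direction of averaging moves the interval of integration, so this is the
  fundamental theorem of calculus.\<close>

lemma partial_axis_avg_same:
  assumes "t > 0" and g: "continuous_on UNIV g"
  shows "((\<lambda>\<tau>. axis_avg t i g (x + \<tau> *\<^sub>R axis i 1)) has_field_derivative axis_diff t i g x) (at 0)"
proof -
  define \<phi> where "\<phi> v = g (x + v *\<^sub>R axis i 1)" for v
  \<comment> \<open>An interval that contains all the shifts of \<open>{-t..t}\<close> by less than \<open>1\<close>.\<close>
  define I where "I = {-(t+1)..t+1}"
  have "continuous_on I \<phi>"
    unfolding \<phi>_def by (rule continuous_along_axis [OF g])
  then obtain \<Phi> where \<Phi>: "\<And>v. v \<in> I \<Longrightarrow> (\<Phi> has_vector_derivative \<phi> v) (at v within I)"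
    unfolding I_def by (rule antiderivative_continuous) blast
  have \<Phi>': "(\<Phi> has_field_derivative \<phi> v) (at v)" if "\<bar>v\<bar> < t + 1" for v
  proof -
    have "v \<in> interior I"
      using that by (auto simp: I_def)
    then show ?thesis
      using \<Phi> [of v] interior_subset [of I] at_within_interior [of v I]
      by (auto simp: has_real_derivative_iff_has_vector_derivative)
  qed
  have avg: "axis_avg t i g (x + \<tau> *\<^sub>R axis i 1) = (\<Phi> (t + \<tau>) - \<Phi> (- t + \<tau>)) / (2 * t)"
    if "\<bar>\<tau>\<bar> < 1" for \<tau>
  proof -
    have "((\<lambda>u. \<phi> (u + \<tau>)) has_integral (\<Phi> (t + \<tau>) - \<Phi> (- t + \<tau>))) {-t..t}"
    proof (rule fundamental_theorem_of_calculus [where f = "\<lambda>u. \<Phi> (u + \<tau>)"])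
      fix u assume u: "u \<in> {-t..t}"
      have "((\<lambda>u. \<Phi> (u + \<tau>)) has_field_derivative \<phi> (u + \<tau>)) (at u)"
        using \<Phi>' [of "u + \<tau>"] u that by (intro DERIV_shift [THEN iffD1]) auto
      then show "((\<lambda>u. \<Phi> (u + \<tau>)) has_vector_derivative \<phi> (u + \<tau>)) (at u within {-t..t})"
        using has_field_derivative_at_within has_real_derivative_iff_has_vector_derivative by blast
    qed (use \<open>t > 0\<close> in simp)
    then show ?thesis
      by (auto simp: axis_avg_def \<phi>_def algebra_simps dest!: integral_unique)
  qed
  have d: "((\<lambda>\<tau>. (\<Phi> (t + \<tau>) - \<Phi> (- t + \<tau>)) / (2 * t)) has_field_derivative
          (\<phi> t - \<phi> (- t)) / (2 * t)) (at 0)"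
  proof -
    have "((\<lambda>\<tau>. \<Phi> (\<tau> + t)) has_field_derivative \<phi> t) (at 0)"
      "((\<lambda>\<tau>. \<Phi> (\<tau> + - t)) has_field_derivative \<phi> (- t)) (at 0)"
      using \<Phi>' [of t] \<Phi>' [of "- t"] \<open>t > 0\<close>
        DERIV_shift [of \<Phi> "\<phi> t" 0 t] DERIV_shift [of \<Phi> "\<phi> (-t)" 0 "-t"] by auto
    from DERIV_cdivide [OF DERIV_diff [OF this], of "2 * t"] show ?thesis
      by (simp add: add.commute)
  qed
  have ev: "\<forall>\<^sub>F \<tau> in nhds 0. (\<Phi> (t + \<tau>) - \<Phi> (- t + \<tau>)) / (2 * t)
       = axis_avg t i g (x + \<tau> *\<^sub>R axis i 1)"
    unfolding eventually_nhds_metric using avg by (intro exI [of _ 1]) auto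
  have eq: "(\<phi> t - \<phi> (- t)) / (2 * t) = axis_diff t i g x"
    by (simp add: axis_diff_def \<phi>_def)
  show ?thesis
    by (rule DERIV_cong_ev [THEN iffD1, OF refl ev eq d])
qed

text \<open>In the other directions the derivative is taken under the integral sign.\<close>

lemma partial_axis_avg_other:
  fixes g :: "real ^ 'd::finite \<Rightarrow> real"
  assumes g: "continuous_on UNIV g"
    and part: "\<And>x. has_partial i g x" and cont: "continuous_on UNIV (partial_deriv i g)"
  shows "((\<lambda>\<tau>. axis_avg t j g (x + \<tau> *\<^sub>R axis i 1)) has_field_derivative
           axis_avg t j (partial_deriv i g) x) (at 0)"
proof -
  have eq: "x + \<tau> *\<^sub>R axis i 1 + u *\<^sub>R axis j 1 = (x + u *\<^sub>R axis j 1) + \<tau> *\<^sub>R axis i 1" for \<tau> u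
    by (simp add: algebra_simps)
  have "((\<lambda>\<tau>. integral (cbox (-t) t) (\<lambda>u. g (x + \<tau> *\<^sub>R axis i 1 + u *\<^sub>R axis j 1)))
     has_field_derivative integral (cbox (-t) t)
        (\<lambda>u. partial_deriv i g (x + 0 *\<^sub>R axis i 1 + u *\<^sub>R axis j 1))) (at 0 within UNIV)"
  proof (rule leibniz_rule_field_derivative)
    fix \<tau> u :: real
    show "((\<lambda>\<tau>. g (x + \<tau> *\<^sub>R axis i 1 + u *\<^sub>R axis j 1)) has_field_derivative
        partial_deriv i g (x + \<tau> *\<^sub>R axis i 1 + u *\<^sub>R axis j 1)) (at \<tau> within UNIV)"
      unfolding eq using has_partialD [OF part] by simp
    show "(\<lambda>u. g (x + \<tau> *\<^sub>R axis i 1 + u *\<^sub>R axis j 1)) integrable_on cbox (-t) t"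
      using integrable_along_axis [OF g] by simp
    show "continuous_on (UNIV \<times> cbox (-t) t)
        (\<lambda>(\<tau>, u). partial_deriv i g (x + \<tau> *\<^sub>R axis i 1 + u *\<^sub>R axis j 1))"
      unfolding case_prod_beta
      by (rule continuous_on_compose2 [OF cont]) (auto intro!: continuous_intros)
  qed auto
  then show ?thesis
    unfolding axis_avg_def by (auto intro: DERIV_cdivide)
qed

lemma partial_axis_diff:
  assumes "\<And>x. has_partial i g x"
  shows "((\<lambda>\<tau>. axis_diff t j g (x + \<tau> *\<^sub>R axis i 1)) has_field_derivative
           axis_diff t j (partial_deriv i g) x) (at 0)"
proof -
  have "((\<lambda>\<tau>. g (z + \<tau> *\<^sub>R axis i 1)) has_field_derivative partial_deriv i g z) (at 0)" for z
    using has_partialD [of i g z 0] assms by simp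
  from DERIV_cdivide [OF DERIV_diff [OF this [of "x + t *\<^sub>R axis j 1"] this [of "x - t *\<^sub>R axis j 1"]],
      of "2 * t"]
  show ?thesis
    by (simp add: axis_diff_def algebra_simps)
qed

section \<open>Functions obtained by averaging and differencing\<close>

text \<open>The functions obtained from \<open>f\<close> by \<open>k\<close> difference quotients and, in direction \<open>i\<close>, by \<open>b i\<close>
  averages, in any order. Differentiation in direction \<open>i\<close> turns one of these averages into a
  difference quotient (\<open>smoothed_partial\<close>), so the family is closed under derivatives as long as
  averages are left. As the order of the operators is left open, they need not be commuted.\<close>

inductive smoothed :: "real \<Rightarrow> (real ^ 'd::finite \<Rightarrow> real) \<Rightarrow> ('d \<Rightarrow> nat) \<Rightarrow> nat
    \<Rightarrow> (real ^ 'd \<Rightarrow> real) \<Rightarrow> bool" for t f where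
  base: "smoothed t f (\<lambda>_. 0) 0 f"
| avg: "smoothed t f b k g \<Longrightarrow> smoothed t f (b(i := Suc (b i))) k (axis_avg t i g)"
| diff: "smoothed t f b k g \<Longrightarrow> smoothed t f b (Suc k) (axis_diff t i g)"

lemma smoothed_lipschitz:
  assumes "smoothed t f b k g" and "t > 0" and "l1_lipschitz L f"
  shows "l1_lipschitz (L / t ^ k) g"
  using assms
proof (induction rule: smoothed.induct)
  case (diff b k g i)
  then show ?case
    using axis_diff_lipschitz [of t "L / t ^ k" g i] by (simp add: field_simps)
next
  case (avg b k g i)
  then show ?case
    by (intro axis_avg_lipschitz) auto
qed simp

lemmas smoothed_continuous = l1_lipschitz_continuous [OF smoothed_lipschitz]

text \<open>Among the \<open>k\<close> difference quotients, the outermost costs only the Lipschitz constant of the function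
  that it is applied to; each of the others has divided this constant by \<open>t\<close>. This is where the
  exponent \<open>k - 1\<close>, instead of \<open>k\<close>, comes from.\<close>

lemma smoothed_bound:
  assumes "smoothed t f b k g" and "k > 0" and "t > 0" and "l1_lipschitz L f"
  shows "\<bar>g x\<bar> \<le> L / t ^ (k - 1)"
  using assms
proof (induction arbitrary: x rule: smoothed.induct)
  case (avg b k g i)
  note g = smoothed_continuous [OF avg.hyps \<open>t > 0\<close> avg.prems(3)]
  have "- (L / t ^ (k - 1)) \<le> g y \<and> g y \<le> L / t ^ (k - 1)" for y
    using avg.IH [OF avg.prems, of y] by (simp add: abs_le_iff)
  then have "- (L / t ^ (k - 1)) \<le> axis_avg t i g x \<and> axis_avg t i g x \<le> L / t ^ (k - 1)"
    by (intro axis_avg_bounds [OF \<open>t > 0\<close> g])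
  then show ?case
    by (simp add: abs_le_iff)
next
  case (diff b k g i)
  then show ?case
    using axis_diff_bound [OF \<open>t > 0\<close> smoothed_lipschitz [OF diff.hyps \<open>t > 0\<close> diff.prems(3)]]
    by simp
qed simp

text \<open>Averages are local: each of them looks at most \<open>t\<close> further in the sum norm.\<close>

lemma smoothed_range:
  assumes "smoothed t f b 0 g" and "t > 0" and "l1_lipschitz L f"
    and "\<And>y. l1_norm (y - x) \<le> t * (\<Sum>i\<in>UNIV. real (b i)) \<Longrightarrow> A \<le> f y \<and> f y \<le> B"
  shows "A \<le> g x \<and> g x \<le> B"
  using assms
proof (induction b "0::nat" g arbitrary: x rule: smoothed.induct)
  case base
  then show ?case
    by (simp add: l1_norm_def)
next
  case (avg b g i)
  have sum: "(\<Sum>j\<in>UNIV. real ((b(i := Suc (b i))) j)) = (\<Sum>j\<in>UNIV. real (b j)) + 1"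
    by (simp add: sum.remove [of UNIV i])
  have "A \<le> g (x + u *\<^sub>R axis i 1) \<and> g (x + u *\<^sub>R axis i 1) \<le> B" if "\<bar>u\<bar> \<le> t" for u
  proof (rule avg.hyps(2) [OF \<open>t > 0\<close> avg.prems(2)])
    fix y assume y: "l1_norm (y - (x + u *\<^sub>R axis i 1)) \<le> t * (\<Sum>i\<in>UNIV. real (b i))"
    have "l1_norm (y - x) \<le> l1_norm (y - (x + u *\<^sub>R axis i 1)) + l1_norm (u *\<^sub>R axis i (1::real))"
      using l1_norm_triangle [of "y - (x + u *\<^sub>R axis i 1)" "u *\<^sub>R axis i 1"] by simp
    with y that have "l1_norm (y - x) \<le> t * (\<Sum>j\<in>UNIV. real ((b(i := Suc (b i))) j))"
      unfolding sum l1_norm_axis by (simp add: distrib_left)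
    then show "A \<le> f y \<and> f y \<le> B"
      by (rule avg.prems(3))
  qed
  then show ?case
    by (intro axis_avg_bounds [OF \<open>t > 0\<close> smoothed_continuous [OF avg.hyps(1) \<open>t > 0\<close> avg.prems(2)]])
qed

lemma smoothed_uminus:
  assumes "smoothed t f b k g"
  shows "smoothed t (\<lambda>x. - f x) b k (\<lambda>x. - g x)"
  using assms
proof (induction rule: smoothed.induct)
  case (avg b k g i)
  have "axis_avg t i (\<lambda>x. - g x) = (\<lambda>x. - axis_avg t i g x)"
    by (rule ext) (simp add: axis_avg_def)
  then show ?case
    using smoothed.avg [OF avg.IH, of i] by (simp only:)
next
  case (diff b k g i)
  have "axis_diff t i (\<lambda>x. - g x) = (\<lambda>x. - axis_diff t i g x)"
    by (rule ext) (simp add: axis_diff_def minus_divide_left)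
  then show ?case
    using smoothed.diff [OF diff.IH, of i] by simp
qed (rule smoothed.base)

lemma smoothed_partial:
  assumes "smoothed t f b k g" and "b i > 0" and "t > 0" and "l1_lipschitz L f"
  shows "(\<forall>x. has_partial i g x) \<and> smoothed t f (b(i := b i - 1)) (Suc k) (partial_deriv i g)"
  using assms
proof (induction rule: smoothed.induct)
  case base
  then show ?case by simp
next
  case (avg b k g j)
  have g: "continuous_on UNIV g"
    using smoothed_continuous [OF avg.hyps \<open>t > 0\<close> avg.prems(3)] .
  show ?case
  proof (cases "i = j")
    case True
    have *: "((\<lambda>\<tau>. axis_avg t j g (x + \<tau> *\<^sub>R axis i 1)) has_field_derivative axis_diff t i g x) (at 0)" for x
      unfolding True by (rule partial_axis_avg_same [OF \<open>t > 0\<close> g])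
    have "partial_deriv i (axis_avg t j g) = axis_diff t i g"
      using has_partialI(2) [OF *] by blast
    moreover have "(b(j := Suc (b j)))(i := (b(j := Suc (b j))) i - 1) = b"
      using True by auto
    ultimately show ?thesis
      using has_partialI(1) [OF *] smoothed.diff [OF avg.hyps, of i] by (simp only:) blast
  next
    case False
    then have "b i > 0"
      using avg.prems(1) by simp
    note IH = conjunct1 [OF avg.IH [OF this avg.prems(2,3)]]
      conjunct2 [OF avg.IH [OF this avg.prems(2,3)]]
    have *: "((\<lambda>\<tau>. axis_avg t j g (x + \<tau> *\<^sub>R axis i 1)) has_field_derivative
        axis_avg t j (partial_deriv i g) x) (at 0)" for x
      using IH(1) smoothed_continuous [OF IH(2) \<open>t > 0\<close> avg.prems(3)]
      by (intro partial_axis_avg_other [OF g]) auto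
    have "partial_deriv i (axis_avg t j g) = axis_avg t j (partial_deriv i g)"
      using has_partialI(2) [OF *] by blast
    moreover have "(b(i := b i - 1))(j := Suc ((b(i := b i - 1)) j))
        = (b(j := Suc (b j)))(i := (b(j := Suc (b j))) i - 1)"
      using False by auto
    ultimately show ?thesis
      using has_partialI(1) [OF *] smoothed.avg [OF IH(2), of j] by (simp only:) blast
  qed
next
  case (diff b k g j)
  note IH = conjunct1 [OF diff.IH [OF diff.prems]] conjunct2 [OF diff.IH [OF diff.prems]]
  have *: "((\<lambda>\<tau>. axis_diff t j g (x + \<tau> *\<^sub>R axis i 1)) has_field_derivative
        axis_diff t j (partial_deriv i g) x) (at 0)" for x
    using IH(1) by (intro partial_axis_diff) auto
  have "partial_deriv i (axis_diff t j g) = axis_diff t j (partial_deriv i g)"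
    using has_partialI(2) [OF *] by blast
  then show ?case
    using has_partialI(1) [OF *] smoothed.diff [OF IH(2), of j] by (simp only:) blast
qed

lemma smoothed_cont_diff:
  assumes "smoothed t f b k g" and "\<And>i. r \<le> b i" and "t > 0" and "l1_lipschitz L f"
  shows "cont_diff_on r D g"
  using assms
proof (induction r arbitrary: b k g)
  case 0
  then show ?case
    by (metis cont_diff_on.simps(1) continuous_on_subset smoothed_continuous subset_UNIV)
next
  case (Suc r)
  have "has_partial i g x \<and> cont_diff_on r D (partial_deriv i g)" for i x
  proof -
    have bi: "b i > 0" for i
      using Suc.prems(2) [of i] by simp
    have *: "(\<forall>x. has_partial i g x) \<and> smoothed t f (b(i := b i - 1)) (Suc k) (partial_deriv i g)"
      by (rule smoothed_partial [OF Suc.prems(1) bi Suc.prems(3,4)])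
    have "r \<le> (b(i := b i - 1)) j" for j
      using Suc.prems(2) [of j] by (cases "j = i") auto
    from Suc.IH [OF conjunct2 [OF *] this Suc.prems(3,4)]
    have "cont_diff_on r D (partial_deriv i g)" .
    with * show ?thesis by blast
  qed
  moreover have "continuous_on D g"
    by (meson Suc.prems continuous_on_subset smoothed_continuous subset_UNIV)
  ultimately show ?case by simp
qed

text \<open>For iterated derivatives it suffices to know how many averages remain in every direction;
  each derivative uses up at most one of them, whatever its direction.\<close>

lemma smoothed_partial_funpow:
  assumes "smoothed t f b k g" and "\<And>i. m + n \<le> b i" and "t > 0" and "l1_lipschitz L f"
  shows "\<exists>b'. (\<forall>i. m \<le> b' i) \<and> smoothed t f b' (k + n) ((partial_deriv i ^^ n) g)"
  using assms(2)
proof (induction n arbitrary: m)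
  case 0
  then show ?case
    using assms(1) by auto
next
  case (Suc n)
  then obtain b' where b': "\<forall>j. Suc m \<le> b' j" "smoothed t f b' (k + n) ((partial_deriv i ^^ n) g)"
    by (metis add_Suc_shift)
  have "b' i > 0"
    using b'(1) by (metis less_le_trans zero_less_Suc)
  from smoothed_partial [OF b'(2) this assms(3,4)]
  have "smoothed t f (b'(i := b' i - 1)) (k + Suc n) ((partial_deriv i ^^ Suc n) g)"
    by simp
  moreover have "\<forall>j. m \<le> (b'(i := b' i - 1)) j"
  proof
    fix j
    show "m \<le> (b'(i := b' i - 1)) j"
      using b'(1) [rule_format, of j] by (cases "j = i") auto
  qed
  ultimately show ?case by blast
qed

lemma smoothed_multi_deriv:
  assumes "smoothed t f b k g" and "\<And>i. (\<Sum>i\<in>UNIV. \<beta> i) \<le> b i" and "t > 0" and "l1_lipschitz L f"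
  shows "\<exists>b'. smoothed t f b' (k + (\<Sum>i\<in>UNIV. \<beta> i)) (multi_deriv \<beta> g)"
proof -
  have "\<exists>b'. (\<forall>i. m \<le> b' i) \<and> smoothed t f b' (k + sum_list (map \<beta> xs))
           (foldr (\<lambda>i. partial_deriv i ^^ \<beta> i) xs g)"
    if "\<And>i. m + sum_list (map \<beta> xs) \<le> b i" for xs m
    using that
  proof (induction xs arbitrary: m)
    case Nil
    then show ?case
      using assms(1) by auto
  next
    case (Cons j xs)
    have "\<And>i. (m + \<beta> j) + sum_list (map \<beta> xs) \<le> b i"
      using Cons.prems by (simp add: add.assoc)
    from Cons.IH [OF this] obtain b' where b': "\<And>i. m + \<beta> j \<le> b' i"
      "smoothed t f b' (k + sum_list (map \<beta> xs)) (foldr (\<lambda>i. partial_deriv i ^^ \<beta> i) xs g)"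
      by blast
    from smoothed_partial_funpow [OF b'(2,1) assms(3,4)] show ?case
      by (simp add: ac_simps)
  qed
  from this [of 0 coords] assms(2) show ?thesis
    by (auto simp: multi_deriv_def sum_list_distinct_conv_sum_set coords)
qed

text \<open>Averaging over the cube with centre \<open>x\<close> and side \<open>2 t\<close>, one coordinate at a time.\<close>

definition box_avg :: "real \<Rightarrow> (real ^ 'd::finite \<Rightarrow> real) \<Rightarrow> real ^ 'd \<Rightarrow> real" where
  "box_avg t = foldr (axis_avg t) coords"

lemma smoothed_box_avg:
  assumes "smoothed t f b k g"
  shows "smoothed t f (\<lambda>i. Suc (b i)) k (box_avg t g)"
proof -
  have "distinct xs \<Longrightarrow> smoothed t f (\<lambda>i. if i \<in> set xs then Suc (b i) else b i) k (foldr (axis_avg t) xs g)"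
    for xs
  proof (induction xs)
    case Nil
    then show ?case using assms by simp
  next
    case (Cons j xs)
    then have "smoothed t f ((\<lambda>i. if i \<in> set xs then Suc (b i) else b i)(j := Suc (b j))) k
        (foldr (axis_avg t) (j # xs) g)"
      using smoothed.avg [of t f _ k "foldr (axis_avg t) xs g" j] by fastforce
    moreover have "(\<lambda>i. if i \<in> set xs then Suc (b i) else b i)(j := Suc (b j))
        = (\<lambda>i. if i \<in> set (j # xs) then Suc (b i) else b i)"
      by auto
    ultimately show ?case by simp
  qed
  from this [of coords] show ?thesis
    by (simp add: box_avg_def coords)
qed

lemma smoothed_box_avg_funpow: "smoothed t f (\<lambda>_. m) 0 ((box_avg t ^^ m) f)"
  by (induction m) (auto intro: smoothed.base smoothed_box_avg)

section \<open>Fooling functions\<close>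

text \<open>A derivative of order \<open>k \<ge> 1\<close> is at most \<open>t\<^bsup>r-1\<^esup> / t\<^bsup>k-1\<^esup>\<close>, hence at most \<open>1\<close> for \<open>k \<le> r\<close>;
  the slope allowed for \<open>f\<close> is the one that gives \<open>1\<close> for \<open>k = r\<close>. For \<open>k = 0\<close> averaging keeps the
  bound of \<open>f\<close>.\<close>

lemma C_class_of_smoothed:
  assumes "smoothed t f (\<lambda>_. r) 0 F" and "0 < t" and "t \<le> 1"
    and L: "l1_lipschitz (t ^ (r - 1)) f" and f: "\<And>x. \<bar>f x\<bar> \<le> 1"
  shows "F \<in> C_class r D"
proof -
  have "\<bar>multi_deriv \<beta> F x\<bar> \<le> 1" if \<beta>: "(\<Sum>i\<in>UNIV. \<beta> i) \<le> r" for \<beta> x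
  proof -
    let ?k = "\<Sum>i\<in>UNIV. \<beta> i"
    obtain b' where b': "smoothed t f b' ?k (multi_deriv \<beta> F)"
      using smoothed_multi_deriv [OF assms(1) _ \<open>0 < t\<close> L, of \<beta>] \<beta> by auto
    show ?thesis
    proof (cases "?k = 0")
      case True
      have "- 1 \<le> f y \<and> f y \<le> 1" for y
        using f [of y] by (simp add: abs_le_iff)
      moreover have "smoothed t f b' 0 (multi_deriv \<beta> F)"
        using b' unfolding True .
      ultimately have "- 1 \<le> multi_deriv \<beta> F x \<and> multi_deriv \<beta> F x \<le> 1"
        using \<open>0 < t\<close> L by (intro smoothed_range)
      then show ?thesis
        by (simp add: abs_le_iff)
    next
      case False
      then have "\<bar>multi_deriv \<beta> F x\<bar> \<le> t ^ (r - 1) / t ^ (?k - 1)"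
        by (intro smoothed_bound [OF b' _ \<open>0 < t\<close> L]) (simp only: neq0_conv)
      also have "\<dots> \<le> 1"
        using \<open>0 < t\<close> \<open>t \<le> 1\<close> \<beta> by (simp add: power_decreasing)
      finally show ?thesis .
    qed
  qed
  moreover have "cont_diff_on r D F"
    by (rule smoothed_cont_diff [OF assms(1) order_refl \<open>0 < t\<close> L])
  ultimately show ?thesis
    by (simp add: C_class_def)
qed

text \<open>The function before smoothing is the minimum of \<open>h\<close> and of the cones
  \<open>s max 0 (l1_norm (x - p) - R)\<close>. Adding the points one by one covers the empty set of points too,
  where a distance to the set would have no meaning.\<close>

lemma exists_l1_plateau:
  fixes P :: "(real ^ 'd::finite) set"
  assumes "finite P" and "s > 0" and "h \<ge> 0"
  shows "\<exists>f. l1_lipschitz s f \<and> (\<forall>x. 0 \<le> f x \<and> f x \<le> h) \<and>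
    (\<forall>p\<in>P. \<forall>x. l1_norm (x - p) \<le> R \<longrightarrow> f x = 0) \<and>
    (\<forall>x. (\<forall>p\<in>P. R + h / s \<le> l1_norm (x - p)) \<longrightarrow> f x = h)"
  using assms(1)
proof (induction P)
  case empty
  have "l1_lipschitz s (\<lambda>_. h)"
    using \<open>s > 0\<close> by (simp add: l1_lipschitz_def l1_norm_nonneg)
  then show ?case
    using \<open>h \<ge> 0\<close> by (intro exI [of _ "\<lambda>_. h"]) auto
next
  case (insert p P)
  then obtain f where f: "l1_lipschitz s f" "\<And>x. 0 \<le> f x \<and> f x \<le> h"
    "\<And>p x. p \<in> P \<Longrightarrow> l1_norm (x - p) \<le> R \<Longrightarrow> f x = 0"
    "\<And>x. (\<And>p. p \<in> P \<Longrightarrow> R + h / s \<le> l1_norm (x - p)) \<Longrightarrow> f x = h"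
    by blast
  define q where "q x = s * max 0 (l1_norm (x - p) - R)" for x
  have q0: "0 \<le> q x" for x
    using \<open>s > 0\<close> by (simp add: q_def)
  have q1: "q x - q y \<le> s * l1_norm (x - y)" for x y
  proof -
    have "l1_norm (x - p) \<le> l1_norm (x - y) + l1_norm (y - p)"
      using l1_norm_triangle [of "x - y" "y - p"] by simp
    then have "max 0 (l1_norm (x - p) - R) - max 0 (l1_norm (y - p) - R) \<le> l1_norm (x - y)"
      using l1_norm_nonneg [of "x - y"] by linarith
    then show ?thesis
      using \<open>s > 0\<close> by (simp add: q_def flip: right_diff_distrib)
  qed
  have q2: "\<bar>q x - q y\<bar> \<le> s * l1_norm (x - y)" for x y
    using q1 [of x y] q1 [of y x] l1_norm_minus [of "x - y"] by (simp add: abs_le_iff)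
  have "l1_lipschitz s (\<lambda>x. min (f x) (q x))"
    unfolding l1_lipschitz_def
  proof (intro allI)
    fix x y
    show "\<bar>min (f x) (q x) - min (f y) (q y)\<bar> \<le> s * l1_norm (x - y)"
      using q2 [of x y] l1_lipschitzD [OF f(1), of x y] by linarith
  qed
  moreover have "0 \<le> min (f x) (q x) \<and> min (f x) (q x) \<le> h" for x
    using q0 [of x] f(2) [of x] by auto
  moreover have "min (f x) (q x) = 0" if "p' \<in> insert p P" "l1_norm (x - p') \<le> R" for p' x
    using that q0 [of x] f(2) [of x] f(3) [of p' x] by (auto simp: q_def)
  moreover have "min (f x) (q x) = h" if "\<And>p'. p' \<in> insert p P \<Longrightarrow> R + h / s \<le> l1_norm (x - p')" for x
  proof -
    have "h / s \<le> max 0 (l1_norm (x - p) - R)"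
      using that [of p] by simp
    then have "h \<le> q x"
      using \<open>s > 0\<close> by (simp add: q_def field_simps)
    moreover have "f x = h"
      using that by (intro f(4)) auto
    ultimately show ?thesis by simp
  qed
  ultimately show ?case
    by (intro exI [of _ "\<lambda>x. min (f x) (q x)"]) blast
qed

text \<open>The radius of the balls is made of three pieces of equal length \<open>R = d r t\<close>. The middle one is
  the slope of the unsmoothed function. The inner and the outer one keep the sample points and
  the plateau out of reach of the slope, since smoothing looks at distance \<open>R\<close>.\<close>

lemma exists_fooling_function:
  fixes P D :: "(real ^ 'd::finite) set"
  assumes "finite P" and "r \<ge> 1" and "0 < t" and "t \<le> 1"
    and h: "h = real CARD('d) * real r * t ^ r" and "h \<le> 1"
  shows "\<exists>F. F \<in> C_class r D \<and> (\<lambda>x. - F x) \<in> C_class r D \<and> continuous_on UNIV F \<and>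
    (\<forall>x. 0 \<le> F x \<and> F x \<le> h) \<and> (\<forall>p\<in>P. F p = 0) \<and>
    (\<forall>x. (\<forall>p\<in>P. 3 * (real CARD('d) * real r * t) \<le> l1_norm (x - p)) \<longrightarrow> F x = h)"
proof -
  define R where "R = real CARD('d) * real r * t"
  have "h \<ge> 0" and tr: "t ^ (r - 1) > 0"
    using \<open>0 < t\<close> by (simp_all add: h)
  have "t ^ r = t * t ^ (r - 1)"
    using \<open>r \<ge> 1\<close> by (metis Suc_diff_1 less_le_trans power_Suc zero_less_one)
  then have hR: "h / t ^ (r - 1) = R"
    using \<open>0 < t\<close> by (simp add: h R_def)
  obtain f where f: "l1_lipschitz (t ^ (r - 1)) f" "\<And>x. 0 \<le> f x \<and> f x \<le> h"
    "\<And>p x. p \<in> P \<Longrightarrow> l1_norm (x - p) \<le> R \<Longrightarrow> f x = 0"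
    "\<And>x. (\<And>p. p \<in> P \<Longrightarrow> R + R \<le> l1_norm (x - p)) \<Longrightarrow> f x = h"
    using exists_l1_plateau [OF assms(1) tr \<open>h \<ge> 0\<close>, of R] unfolding hR by blast
  define F where "F = (box_avg t ^^ r) f"
  have F: "smoothed t f (\<lambda>_. r) 0 F"
    unfolding F_def by (rule smoothed_box_avg_funpow)
  have range: "A \<le> F x \<and> F x \<le> B" if "\<And>y. l1_norm (y - x) \<le> R \<Longrightarrow> A \<le> f y \<and> f y \<le> B" for A B x
    by (rule smoothed_range [OF F \<open>0 < t\<close> f(1)], rule that) (simp add: R_def ac_simps)
  have f1: "\<bar>f x\<bar> \<le> 1" for x
    using f(2) [of x] \<open>h \<le> 1\<close> by (simp add: abs_le_iff)
  have "F \<in> C_class r D"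
    by (rule C_class_of_smoothed [OF F \<open>0 < t\<close> \<open>t \<le> 1\<close> f(1) f1])
  moreover have "(\<lambda>x. - F x) \<in> C_class r D"
    by (rule C_class_of_smoothed [OF smoothed_uminus [OF F] \<open>0 < t\<close> \<open>t \<le> 1\<close> l1_lipschitz_uminus [OF f(1)]])
      (simp add: f1)
  moreover have "continuous_on UNIV F"
    by (rule smoothed_continuous [OF F \<open>0 < t\<close> f(1)])
  moreover have "0 \<le> F x \<and> F x \<le> h" for x
    by (intro range f(2))
  moreover have "F p = 0" if "p \<in> P" for p
    using range [of p 0 0] f(3) [OF that] by fastforce
  moreover have "F x = h" if x: "\<And>p. p \<in> P \<Longrightarrow> 3 * R \<le> l1_norm (x - p)" for x
  proof -
    have "f y = h" if y: "l1_norm (y - x) \<le> R" for y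
    proof (rule f(4))
      fix p assume "p \<in> P"
      have "l1_norm (x - p) \<le> l1_norm (x - y) + l1_norm (y - p)"
        using l1_norm_triangle [of "x - y" "y - p"] by simp
      moreover have "l1_norm (x - y) \<le> R"
        using y l1_norm_minus [of "y - x"] by simp
      ultimately show "R + R \<le> l1_norm (y - p)"
        using x [OF \<open>p \<in> P\<close>] by linarith
    qed
    then show ?thesis
      using range [of x h h] by fastforce
  qed
  ultimately show ?thesis
    unfolding R_def by blast
qed

section \<open>The volume of balls in the sum norm\<close>

text \<open>The integrand is covered by two one-sided exponentials, each with integral \<open>1 / \<mu>\<close>.\<close>

lemma nn_integral_exp_abs_le:
  fixes c \<mu> :: real
  assumes "\<mu> > 0"
  shows "(\<integral>\<^sup>+x. ennreal (exp (- \<mu> * \<bar>x - c\<bar>)) \<partial>lborel) \<le> ennreal (2 / \<mu>)"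
proof -
  define g where "g y = ennreal (exp (- \<mu> * y)) * indicator {0..} y" for y
  have [measurable]: "g \<in> borel_measurable borel"
    unfolding g_def by measurable
  have g: "integral\<^sup>N lborel g = ennreal (1 / \<mu>)"
  proof -
    have "((\<lambda>x. - exp (- \<mu> * x) / \<mu>) \<longlongrightarrow> - 0 / \<mu>) at_top"
    proof (intro tendsto_intros filterlim_compose [OF exp_at_bot])
      show "LIM x at_top. - \<mu> * x :> at_bot"
        using assms by (intro filterlim_tendsto_neg_mult_at_bot [OF tendsto_const] filterlim_ident) auto
    qed (use assms in auto)
    then have "integral\<^sup>N lborel g = ennreal (0 - (- exp (- \<mu> * 0) / \<mu>))"
      unfolding g_def using assms
      by (intro nn_integral_FTC_atLeast) (auto intro!: derivative_eq_intros)
    then show ?thesis by simp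
  qed
  have "(\<integral>\<^sup>+x. ennreal (exp (- \<mu> * \<bar>x - c\<bar>)) \<partial>lborel)
      \<le> (\<integral>\<^sup>+x. g (- c + 1 * x) + g (c + (- 1) * x) \<partial>lborel)"
    by (intro nn_integral_mono) (auto simp: g_def indicator_def abs_if)
  also have "\<dots> = (\<integral>\<^sup>+x. g (- c + 1 * x) \<partial>lborel) + (\<integral>\<^sup>+x. g (c + (- 1) * x) \<partial>lborel)"
    by (intro nn_integral_add) auto
  also have "\<dots> = integral\<^sup>N lborel g + integral\<^sup>N lborel g"
    using nn_integral_real_affine [of g 1 "- c"] nn_integral_real_affine [of g "- 1" c] by simp
  also have "\<dots> = ennreal (2 / \<mu>)"
    unfolding g using assms by (simp add: ennreal_plus [symmetric] del: ennreal_plus)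
  finally show ?thesis .
qed

lemma l1_norm_Basis:
  fixes x :: "real ^ 'd::finite"
  shows "l1_norm x = (\<Sum>b\<in>Basis. \<bar>x \<bullet> b\<bar>)"
proof -
  have Basis: "(Basis :: (real ^ 'd) set) = range (\<lambda>i. axis i 1)"
    by (auto simp: Basis_vec_def)
  have "inj (\<lambda>i :: 'd. axis i (1::real))"
    by (auto simp: inj_def axis_eq_axis)
  then have "(\<Sum>b\<in>range (\<lambda>i :: 'd. axis i 1). \<bar>x \<bullet> b\<bar>) = (\<Sum>i\<in>UNIV. \<bar>x \<bullet> axis i 1\<bar>)"
    by (simp add: sum.reindex)
  then show ?thesis
    by (simp add: l1_norm_def Basis inner_axis)
qed

text \<open>Chernoff's trick: the indicator function of the ball is at most
  \<open>exp (\<mu> (\<rho> - l1_norm (x - p)))\<close>, whose integral factors over the coordinates into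
  \<open>exp (\<mu> \<rho>) (2 / \<mu>)\<^sup>d\<close>. The choice \<open>\<mu> = d / \<rho>\<close> minimizes this.\<close>

lemma emeasure_l1_ball_le:
  fixes p :: "real ^ 'd::finite"
  assumes "\<rho> > 0"
  shows "emeasure lborel {x. l1_norm (x - p) \<le> \<rho>}
      \<le> ennreal ((2 * exp 1 * \<rho> / real CARD('d)) ^ CARD('d))"
proof -
  define d where "d = CARD('d)"
  define \<mu> where "\<mu> = real d / \<rho>"
  have "d > 0" by (simp add: d_def)
  then have "\<mu> > 0" using assms by (simp add: \<mu>_def)
  define B where "B = {x. l1_norm (x - p) \<le> \<rho>}"
  have "closed B"
    unfolding B_def by (intro closed_Collect_le continuous_intros)
  then have [measurable]: "B \<in> sets borel"
    by simp
  have "emeasure lborel B = (\<integral>\<^sup>+x. indicator B x \<partial>lborel)"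
    by (simp add: nn_integral_indicator)
  also have "\<dots> \<le> (\<integral>\<^sup>+x. ennreal (exp (\<mu> * \<rho>)) *
      (\<Prod>b\<in>Basis. ennreal (exp (- \<mu> * \<bar>x \<bullet> b - p \<bullet> b\<bar>))) \<partial>lborel)"
  proof (intro nn_integral_mono)
    fix x
    have "ennreal (exp (\<mu> * \<rho>)) * (\<Prod>b\<in>Basis. ennreal (exp (- \<mu> * \<bar>x \<bullet> b - p \<bullet> b\<bar>)))
        = ennreal (exp (\<mu> * (\<rho> - l1_norm (x - p))))"
      by (simp add: prod_ennreal l1_norm_Basis inner_diff_left exp_sum [symmetric] sum_negf
          sum_distrib_left [symmetric] ennreal_mult [symmetric] exp_add [symmetric] right_diff_distrib)
    moreover have "indicator B x \<le> ennreal (exp (\<mu> * (\<rho> - l1_norm (x - p))))"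
      using \<open>\<mu> > 0\<close> by (auto simp: B_def indicator_def)
    ultimately show "indicator B x \<le> ennreal (exp (\<mu> * \<rho>)) *
        (\<Prod>b\<in>Basis. ennreal (exp (- \<mu> * \<bar>x \<bullet> b - p \<bullet> b\<bar>)))"
      by simp
  qed
  also have "\<dots> = ennreal (exp (\<mu> * \<rho>)) *
      (\<integral>\<^sup>+x. (\<Prod>b\<in>Basis. ennreal (exp (- \<mu> * \<bar>x \<bullet> b - p \<bullet> b\<bar>))) \<partial>lborel)"
    by (intro nn_integral_cmult) measurable
  also have "\<dots> = ennreal (exp (\<mu> * \<rho>)) *
      (\<Prod>b\<in>(Basis :: (real ^ 'd) set). \<integral>\<^sup>+y. ennreal (exp (- \<mu> * \<bar>y - p \<bullet> b\<bar>)) \<partial>lborel)"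
    by (subst nn_integral_lborel_prod) auto
  also have "\<dots> \<le> ennreal (exp (\<mu> * \<rho>)) * (\<Prod>b\<in>(Basis :: (real ^ 'd) set). ennreal (2 / \<mu>))"
    by (intro mult_left_mono prod_mono_ennreal nn_integral_exp_abs_le \<open>\<mu> > 0\<close>) simp_all
  also have "\<dots> = ennreal (exp (\<mu> * \<rho>) * (2 / \<mu>) ^ d)"
    using \<open>\<mu> > 0\<close> by (simp add: ennreal_power ennreal_mult d_def)
  also have "exp (\<mu> * \<rho>) * (2 / \<mu>) ^ d = (2 * exp 1 * \<rho> / real d) ^ d"
  proof -
    have "exp (\<mu> * \<rho>) = exp 1 ^ d"
      using assms by (simp add: \<mu>_def exp_of_nat_mult [symmetric])
    then show ?thesis
      by (simp add: \<mu>_def flip: power_mult_distrib) (simp add: field_simps)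
  qed
  finally show ?thesis
    unfolding B_def d_def .
qed

text \<open>The balls cover at most the measure \<open>card P\<close> times the volume of one ball, and on the rest of \<open>D\<close>
  the integrand is \<open>h\<close>.\<close>

lemma integral_on_ge_plateau:
  fixes D P :: "(real ^ 'd::finite) set"
  assumes "open D" and D: "emeasure lborel D = 1" and F: "continuous_on UNIV F"
    and F0: "\<And>x. 0 \<le> F x" and Fh: "\<And>x. F x \<le> h"
    and plateau: "\<And>x. (\<And>p. p \<in> P \<Longrightarrow> \<rho> \<le> l1_norm (x - p)) \<Longrightarrow> F x = h"
    and "finite P" and "\<rho> > 0"
  shows "h * (1 - real (card P) * (2 * exp 1 * \<rho> / real CARD('d)) ^ CARD('d)) \<le> integral_on D F"
proof -
  define V where "V = (2 * exp 1 * \<rho> / real CARD('d)) ^ CARD('d)"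
  have "V \<ge> 0"
    using \<open>\<rho> > 0\<close> by (simp add: V_def)
  define B where "B p = {x. l1_norm (x - p) \<le> \<rho>}" for p :: "real ^ 'd"
  define U where "U = (\<Union>p\<in>P. B p)"
  have "h \<ge> 0"
    using F0 Fh order_trans by blast
  have B: "B p \<in> sets lborel" for p
  proof -
    have "closed (B p)"
      unfolding B_def by (intro closed_Collect_le continuous_intros)
    then show ?thesis by simp
  qed
  have Bfin: "B p \<in> fmeasurable lborel" and Bm: "measure lborel (B p) \<le> V" for p
  proof -
    have le: "emeasure lborel (B p) \<le> ennreal V"
      unfolding B_def V_def by (rule emeasure_l1_ball_le [OF \<open>\<rho> > 0\<close>])
    then show "B p \<in> fmeasurable lborel"
      using B by (auto simp: fmeasurable_def intro: le_less_trans)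
    show "measure lborel (B p) \<le> V"
      using le \<open>V \<ge> 0\<close> by (simp add: measure_def enn2real_leI)
  qed
  have U: "U \<in> fmeasurable lborel"
    unfolding U_def using Bfin \<open>finite P\<close> by (intro fmeasurable.finite_UN) auto
  have Dfin: "D \<in> fmeasurable lborel"
    using \<open>open D\<close> D by (simp add: fmeasurable_def)
  have sets: "D \<in> sets lborel" "U \<in> sets lborel"
    using Dfin U by (auto dest: fmeasurableD)
  then have DU: "D - U \<in> fmeasurable lborel"
    using Dfin U by (intro fmeasurable.Diff)
  have "measure lborel U \<le> (\<Sum>p\<in>P. measure lborel (B p))"
    unfolding U_def using B by (intro measure_UNION_le \<open>finite P\<close>) auto
  also have "\<dots> \<le> real (card P) * V"
    using Bm sum_bounded_above [of P "\<lambda>p. measure lborel (B p)" V] by simp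
  finally have mU: "measure lborel U \<le> real (card P) * V" .
  have "1 = measure lborel D"
    using D by (simp add: measure_def)
  also have "\<dots> \<le> measure lborel ((D - U) \<union> U)"
    using sets DU U by (intro measure_mono_fmeasurable fmeasurable.Un) auto
  also have "\<dots> \<le> measure lborel (D - U) + measure lborel U"
    using sets by (intro measure_Un_le sets.Diff)
  finally have mDU: "1 - real (card P) * V \<le> measure lborel (D - U)"
    using mU by linarith
  have Fm: "F \<in> borel_measurable lborel"
    using borel_measurable_continuous_onI [OF F] by simp
  have int: "set_integrable lborel D F"
    unfolding set_integrable_def
  proof (rule Bochner_Integration.integrable_bound)
    show "integrable lborel (\<lambda>x. h * indicator D x)"
      using Dfin by (intro integrable_mult_right) (auto simp: fmeasurable_def)
    show "(\<lambda>x. indicator D x *\<^sub>R F x) \<in> borel_measurable lborel"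
      using Fm Dfin by (intro borel_measurable_scaleR borel_measurable_indicator) (auto dest: fmeasurableD)
    show "AE x in lborel. norm (indicator D x *\<^sub>R F x) \<le> norm (h * indicator D x)"
      using F0 Fh \<open>h \<ge> 0\<close> by (intro AE_I2) (auto simp: indicator_def)
  qed
  have "h * (1 - real (card P) * V) \<le> h * measure lborel (D - U)"
    using mDU \<open>h \<ge> 0\<close> by (rule mult_left_mono)
  also have "\<dots> = (LINT x|lborel. h * indicator (D - U) x)"
    using DU by (simp add: fmeasurable_def)
  also have "\<dots> \<le> (LINT x|lborel. indicator D x *\<^sub>R F x)"
  proof (rule integral_mono)
    show "integrable lborel (\<lambda>x. h * indicator (D - U) x :: real)"
      using DU by (intro integrable_mult_right) (auto simp: fmeasurable_def)
    show "integrable lborel (\<lambda>x. indicator D x *\<^sub>R F x)"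
      using int by (simp add: set_integrable_def)
    show "h * indicator (D - U) x \<le> indicator D x *\<^sub>R F x" for x
    proof (cases "x \<in> D - U")
      case True
      then have "F x = h"
        by (intro plateau) (auto simp: U_def B_def)
      then show ?thesis using True by simp
    next
      case False
      then show ?thesis using F0 by (simp add: indicator_def)
    qed
  qed
  finally show ?thesis
    by (simp add: integral_on_def set_lebesgue_integral_def V_def)
qed

section \<open>Adaptive algorithms and the fooling function\<close>

lemma info_zero:
  assumes "\<And>k. k < n \<Longrightarrow> F (\<psi> (replicate k 0)) = 0"
  shows "info \<psi> F n = replicate n 0"
  using assms
proof (induction n)
  case (Suc n)
  then have "info \<psi> F n = replicate n 0"
    by simp
  then show ?case
    using Suc.prems [of n] by (simp add: replicate_append_same)
qed simp

text \<open>The sample points are those that an algorithm visits when all values it sees are \<open>0\<close>. The fooling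
  function and its negative then give the same output, so one of the two errors is at least the
  integral.\<close>

lemma minimal_error_ge:
  fixes D :: "(real ^ 'd::finite) set"
  assumes "open D" and "emeasure lborel D = 1" and "r \<ge> 1" and "0 < t" and "t \<le> 1"
    and h: "h = real CARD('d) * real r * t ^ r" and "h \<le> 1"
  shows "ereal (h * (1 - real n * (6 * exp 1 * real r * t) ^ CARD('d))) \<le> minimal_error r D n"
  unfolding minimal_error_def
proof (rule INF_greatest)
  fix A assume "A \<in> algorithms n D"
  then obtain \<phi> \<psi> where A: "A = (\<lambda>f. \<phi> (info \<psi> f n))"
    by (auto simp: algorithms_def)
  define P where "P = (\<lambda>k. \<psi> (replicate k 0)) ` {..<n}"
  have P: "finite P" "card P \<le> n"
    using card_image_le [of "{..<n}"] by (auto simp: P_def)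
  define \<rho> where "\<rho> = 3 * (real CARD('d) * real r * t)"
  have "\<rho> > 0"
    using \<open>r \<ge> 1\<close> \<open>0 < t\<close> by (simp add: \<rho>_def)
  obtain F where F: "F \<in> C_class r D" "(\<lambda>x. - F x) \<in> C_class r D" "continuous_on UNIV F"
    "\<And>x. 0 \<le> F x" "\<And>x. F x \<le> h" "\<And>p. p \<in> P \<Longrightarrow> F p = 0"
    "\<And>x. (\<And>p. p \<in> P \<Longrightarrow> \<rho> \<le> l1_norm (x - p)) \<Longrightarrow> F x = h"
    using exists_fooling_function [OF P(1) assms(3-5) h \<open>h \<le> 1\<close>, of D] unfolding \<rho>_def by blast
  have AF: "A F = \<phi> (replicate n 0)" "A (\<lambda>x. - F x) = \<phi> (replicate n 0)"
    unfolding A using F(6) by (auto simp: P_def intro!: arg_cong [of _ _ \<phi>] info_zero)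
  have "2 * exp 1 * \<rho> / real CARD('d) = 6 * exp 1 * real r * t"
    by (simp add: \<rho>_def)
  then have "h * (1 - real (card P) * (6 * exp 1 * real r * t) ^ CARD('d)) \<le> integral_on D F"
    using integral_on_ge_plateau [OF assms(1,2) F(3,4,5,7) P(1) \<open>\<rho> > 0\<close>] by simp
  moreover have "h * (1 - real n * (6 * exp 1 * real r * t) ^ CARD('d))
      \<le> h * (1 - real (card P) * (6 * exp 1 * real r * t) ^ CARD('d))"
    using P(2) \<open>0 < t\<close> by (intro mult_left_mono diff_left_mono mult_right_mono) (auto simp: h)
  ultimately have le: "h * (1 - real n * (6 * exp 1 * real r * t) ^ CARD('d)) \<le> integral_on D F"
    by linarith
  have neg: "integral_on D (\<lambda>x. - F x) = - integral_on D F"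
    by (simp add: integral_on_def set_lebesgue_integral_def)
  have "integral_on D F \<le> max \<bar>integral_on D F - A F\<bar> \<bar>integral_on D (\<lambda>x. - F x) - A (\<lambda>x. - F x)\<bar>"
    unfolding AF neg by linarith
  moreover have "ereal \<bar>integral_on D F - A F\<bar> \<le> worst_case_error r D A"
    "ereal \<bar>integral_on D (\<lambda>x. - F x) - A (\<lambda>x. - F x)\<bar> \<le> worst_case_error r D A"
    unfolding worst_case_error_def by (rule SUP_upper, rule F(1), rule SUP_upper, rule F(2))
  ultimately have "ereal (integral_on D F) \<le> worst_case_error r D A"
    by (auto simp: max_def split: if_splits intro: order_trans [OF _ ] elim: order_trans [rotated])
  with le show "ereal (h * (1 - real n * (6 * exp 1 * real r * t) ^ CARD('d))) \<le> worst_case_error r D A"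
    by (meson ereal_less_eq(3) order_trans)
qed

text \<open>A nonempty set of extended naturals contains its infimum, so a lower bound for every admissible \<open>n\<close>
  is one for the complexity; if no \<open>n\<close> is admissible, the complexity is infinite.\<close>

lemma info_complexity_ge:
  assumes "\<And>n. minimal_error r D n \<le> ereal \<epsilon> \<Longrightarrow> x \<le> real n"
  shows "ereal x \<le> ereal_of_enat (info_complexity \<epsilon> D r)"
proof (cases "{n. minimal_error r D n \<le> ereal \<epsilon>} = {}")
  case True
  then show ?thesis
    by (simp add: info_complexity_def top_enat_def)
next
  case False
  then have "info_complexity \<epsilon> D r \<in> enat ` {n. minimal_error r D n \<le> ereal \<epsilon>}"
    unfolding info_complexity_def Inf_enat_def by (auto intro: LeastI)
  then show ?thesis
    using assms by auto
qed

text \<open>This identifies the constant of the lower bound: the right-hand side is the reciprocal of the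
  volume bound for a ball of radius \<open>3 d r t\<close>.\<close>

lemma c_const_power_eq:
  assumes "r \<ge> 1" and "d \<ge> 1" and "h > 0" and t: "t = (h / (real d * real r)) powr (1 / real r)"
  shows "c_const r ^ d * (real d / h) powr (real d / real r) = 1 / (6 * exp 1 * real r * t) ^ d"
proof -
  have pos: "real r > 0" "real d > 0"
    using assms by auto
  have "(real d / h) powr (real d / real r) = ((real d / h) powr (1 / real r)) ^ d"
    using pos \<open>h > 0\<close> by (simp add: powr_realpow [symmetric] powr_powr)
  moreover have "c_const r * (real d / h) powr (1 / real r) = 1 / (6 * exp 1 * real r * t)"
    using pos \<open>h > 0\<close> by (simp add: c_const_def t powr_divide powr_mult powr_diff)
  ultimately show ?thesis
    by (simp add: power_mult_distrib [symmetric] power_one_over)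
qed

lemma info_complexity_lower_bound:
  fixes D :: "(real ^ 'd::finite) set"
  assumes "r \<ge> 1" and "open D" and "emeasure lborel D = 1"
    and \<delta>: "0 < \<delta>" "\<delta> < 1" and \<epsilon>: "0 < \<epsilon>" "\<epsilon> \<le> \<delta>"
  shows "ereal (lower_bound r CARD('d) \<epsilon> \<delta>) \<le> ereal_of_enat (info_complexity \<epsilon> D r)"
proof (rule info_complexity_ge)
  fix n
  assume n: "minimal_error r D n \<le> ereal \<epsilon>"
  define d where "d = CARD('d)"
  have "d \<ge> 1" by (simp add: d_def Suc_le_eq)
  define h where "h = \<epsilon> / \<delta>"
  have h: "h > 0" "h \<le> 1"
    using \<delta> \<epsilon> by (simp_all add: h_def)
  \<comment> \<open>The solution of \<open>h = d r t\<^sup>r\<close>; it is at most \<open>1\<close> because \<open>h \<le> 1 \<le> d r\<close>.\<close>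
  define t where "t = (h / (real d * real r)) powr (1 / real r)"
  have dr: "real d * real r \<ge> 1"
    using \<open>d \<ge> 1\<close> \<open>r \<ge> 1\<close> mult_mono [of 1 "real d" 1 "real r"] by simp
  have "t > 0"
    using h \<open>d \<ge> 1\<close> \<open>r \<ge> 1\<close> by (simp add: t_def)
  have "t \<le> 1"
    unfolding t_def using h dr by (intro powr_le1) auto
  have "t ^ r = h / (real d * real r)"
    using h dr \<open>r \<ge> 1\<close> \<open>t > 0\<close> by (simp add: powr_realpow [symmetric] t_def powr_powr)
  then have hd: "h = real CARD('d) * real r * t ^ r"
    using dr \<open>r \<ge> 1\<close> by (simp add: d_def)
  define V where "V = (6 * exp 1 * real r * t) ^ d"
  have "V > 0"
    using \<open>t > 0\<close> \<open>r \<ge> 1\<close> by (simp add: V_def)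
  have "ereal (h * (1 - real n * V)) \<le> ereal \<epsilon>"
    using minimal_error_ge [OF assms(2,3,1) \<open>t > 0\<close> \<open>t \<le> 1\<close> hd h(2), of n] n
    unfolding V_def d_def by (rule order_trans)
  then have "h * (1 - real n * V) \<le> h * \<delta>"
    using \<delta> by (simp add: h_def)
  then have "1 - \<delta> \<le> real n * V"
    using h by simp
  moreover have "lower_bound r CARD('d) \<epsilon> \<delta> = (1 - \<delta>) / V"
  proof -
    have "\<delta> * real d / \<epsilon> = real d / h"
      using \<delta> \<epsilon> by (simp add: h_def)
    then show ?thesis
      using c_const_power_eq [OF \<open>r \<ge> 1\<close> \<open>d \<ge> 1\<close> h(1) t_def]
      by (simp add: lower_bound_def V_def mult.assoc flip: d_def)
  qed
  ultimately show "lower_bound r CARD('d) \<epsilon> \<delta> \<le> real n"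
    using \<open>V > 0\<close> by (simp add: pos_divide_le_eq)
qed

section \<open>The optimal choice of the parameter\<close>

text \<open>With \<open>m = p / (p + 1)\<close>, apply \<open>y \<le> exp (y - 1)\<close> to both \<open>(1 - \<delta>) / (1 - m)\<close> and \<open>\<delta> / m\<close>. The
  resulting exponents, the second one weighted by \<open>p\<close>, cancel.\<close>

lemma one_minus_times_powr_le:
  fixes p \<delta> :: real
  assumes "p > 0" and "0 < \<delta>" and "\<delta> < 1"
  shows "(1 - \<delta>) * \<delta> powr p \<le> (1 - p / (p + 1)) * (p / (p + 1)) powr p"
proof -
  define m where "m = p / (p + 1)"
  have m: "0 < m" "1 - m = 1 / (p + 1)" "p / m = p + 1"
    using \<open>p > 0\<close> by (simp_all add: m_def field_simps)
  have "(1 - \<delta>) * (p + 1) \<le> exp ((1 - \<delta>) * (p + 1) - 1)"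
    using exp_ge_add_one_self [of "(1 - \<delta>) * (p + 1) - 1"] by simp
  moreover have "(\<delta> / m) powr p \<le> exp (\<delta> / m - 1) powr p"
    using exp_ge_add_one_self [of "\<delta> / m - 1"] assms m by (intro powr_mono2) auto
  ultimately have "((1 - \<delta>) * (p + 1)) * (\<delta> / m) powr p
      \<le> exp ((1 - \<delta>) * (p + 1) - 1) * exp (\<delta> / m - 1) powr p"
    using assms by (intro mult_mono) auto
  also have "\<dots> = exp (((1 - \<delta>) * (p + 1) - 1) + p * (\<delta> / m - 1))"
    by (simp add: powr_def exp_add)
  also have "((1 - \<delta>) * (p + 1) - 1) + p * (\<delta> / m - 1) = 0"
  proof -
    have "p * (\<delta> / m - 1) = \<delta> * (p / m) - p"
      by (simp add: algebra_simps)
    then show ?thesis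
      unfolding m(3) by (simp add: algebra_simps)
  qed
  finally have "((1 - \<delta>) * (p + 1)) * (\<delta> powr p / m powr p) \<le> 1"
    using assms m by (simp add: powr_divide)
  then have "(1 - \<delta>) * \<delta> powr p \<le> (1 / (p + 1)) * m powr p"
    using assms m by (simp add: field_simps)
  then show ?thesis
    using m(2) by (simp add: m_def)
qed

lemma lower_bound_arg_max:
  assumes "r \<ge> 1" and "d \<ge> 1" and "\<epsilon> > 0"
  shows "is_arg_max (lower_bound r d \<epsilon>) (\<lambda>\<delta>. 0 < \<delta> \<and> \<delta> < 1) (real d / (real d + real r))"
proof -
  define p where "p = real d / real r"
  have pos: "real r > 0" "real d > 0" "p > 0"
    using assms by (auto simp: p_def)
  have m: "real d / (real d + real r) = p / (p + 1)"
    using pos by (simp add: p_def field_simps)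
  define K where "K = c_const r ^ d * (real d / \<epsilon>) powr p"
  have "K \<ge> 0"
    by (simp add: K_def c_const_def)
  have eq: "lower_bound r d \<epsilon> \<delta> = ((1 - \<delta>) * \<delta> powr p) * K" if "\<delta> > 0" for \<delta>
    using that pos \<open>\<epsilon> > 0\<close> powr_mult [of \<delta> "real d / \<epsilon>" p]
    by (simp add: lower_bound_def K_def p_def)
  have "lower_bound r d \<epsilon> \<delta> \<le> lower_bound r d \<epsilon> (p / (p + 1))" if "0 < \<delta>" "\<delta> < 1" for \<delta>
    using one_minus_times_powr_le [OF \<open>p > 0\<close> that] that pos \<open>K \<ge> 0\<close>
    by (simp add: eq mult_right_mono)
  moreover have "0 < p / (p + 1)" "p / (p + 1) < 1"
    using pos by simp_all
  ultimately show ?thesis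
    unfolding m by (auto simp: is_arg_max_linorder)
qed

lemma lower_bound_at_arg_max:
  assumes "r \<ge> 1" and "d \<ge> 1" and "\<epsilon> > 0"
  shows "lower_bound r d \<epsilon> (real d / (real d + real r)) = real r / (real r + real d) *
                (real d / (real d + real r) * (1 / (6 ^ r * exp 1 ^ r * real r ^ (r - 1)))
                   * (real d / \<epsilon>)) powr (real d / real r)"
proof -
  have pos: "real r > 0" "real d > 0"
    using assms by auto
  define \<delta> where "\<delta> = real d / (real d + real r)"
  have "\<delta> > 0" and \<delta>: "1 - \<delta> = real r / (real r + real d)"
    using pos by (simp_all add: \<delta>_def field_simps)
  have c: "c_const r > 0"
    using pos by (simp add: c_const_def)
  have "(real r powr (1 - 1 / real r)) ^ r = real r ^ (r - 1)"
  proof -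
    have "(real r powr (1 - 1 / real r)) ^ r = real r powr ((1 - 1 / real r) * real r)"
      using pos by (simp add: powr_realpow [symmetric] powr_powr)
    also have "(1 - 1 / real r) * real r = real (r - 1)"
      using assms(1) by (simp add: field_simps of_nat_diff)
    finally show ?thesis
      using pos by (simp only: powr_realpow)
  qed
  then have cr: "c_const r ^ r = 1 / (6 ^ r * exp 1 ^ r * real r ^ (r - 1))"
    by (simp add: c_const_def power_divide power_mult_distrib)
  have "c_const r ^ d = (c_const r ^ r) powr (real d / real r)"
    using c pos by (simp add: powr_realpow [symmetric] powr_powr)
  then have "lower_bound r d \<epsilon> \<delta> =
      (1 - \<delta>) * (c_const r ^ r * (\<delta> * real d / \<epsilon>)) powr (real d / real r)"
    using powr_mult [of "c_const r ^ r" "\<delta> * real d / \<epsilon>" "real d / real r"]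
    by (simp only: lower_bound_def mult.assoc)
  then show ?thesis
    unfolding \<delta> cr unfolding \<delta>_def by (simp add: ac_simps)
qed

theorem theorem3:
  fixes D :: "(real ^ 'd::finite) set" and r d :: nat
  assumes "r \<ge> 1" and "d = CARD('d)"
    and "open D" and "emeasure lborel D = 1"
  shows "(\<forall>\<delta> \<epsilon>. 0 < \<delta> \<and> \<delta> < 1 \<and> 0 < \<epsilon> \<and> \<epsilon> \<le> \<delta> \<longrightarrow>
            ereal_of_enat (info_complexity \<epsilon> D r) \<ge> ereal (lower_bound r d \<epsilon> \<delta>))
       \<and> (\<forall>\<epsilon>>0. is_arg_max (lower_bound r d \<epsilon>) (\<lambda>\<delta>. 0 < \<delta> \<and> \<delta> < 1) (real d / (real d + real r)))
       \<and> (\<forall>\<epsilon>. 0 < \<epsilon> \<and> \<epsilon> \<le> real d / (real d + real r) \<longrightarrow>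
            ereal_of_enat (info_complexity \<epsilon> D r) \<ge>
              ereal (real r / (real r + real d) *
                (real d / (real d + real r) * (1 / (6 ^ r * exp 1 ^ r * real r ^ (r - 1)))
                   * (real d / \<epsilon>)) powr (real d / real r)))"
proof (intro conjI allI impI)
  have d: "d \<ge> 1"
    using assms(2) by (simp add: Suc_le_eq)
  show *: "ereal (lower_bound r d \<epsilon> \<delta>) \<le> ereal_of_enat (info_complexity \<epsilon> D r)"
    if "0 < \<delta> \<and> \<delta> < 1 \<and> 0 < \<epsilon> \<and> \<epsilon> \<le> \<delta>" for \<delta> \<epsilon>
    unfolding assms(2) using that by (intro info_complexity_lower_bound assms) auto
  show "is_arg_max (lower_bound r d \<epsilon>) (\<lambda>\<delta>. 0 < \<delta> \<and> \<delta> < 1) (real d / (real d + real r))"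
    if "\<epsilon> > 0" for \<epsilon>
    using lower_bound_arg_max [OF assms(1) d that] .
  show "ereal (real r / (real r + real d) *
                (real d / (real d + real r) * (1 / (6 ^ r * exp 1 ^ r * real r ^ (r - 1)))
                   * (real d / \<epsilon>)) powr (real d / real r))
        \<le> ereal_of_enat (info_complexity \<epsilon> D r)"
    if "0 < \<epsilon> \<and> \<epsilon> \<le> real d / (real d + real r)" for \<epsilon>
    using * [of "real d / (real d + real r)" \<epsilon>] lower_bound_at_arg_max [OF assms(1) d, of \<epsilon>] that d assms(1)
    by simp
qed

end
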